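(* Suppose that $X$ is a (real) Hausdorff locally convex topological vector space, with $X^*$ as its (continuous) dual. Assume $F:X\to\mathbb{R}$ is continuous and convex, and that its Legendre dual $F^*$ is strictly convex. Let $K\subset X$ be a closed, convex, non-empty set satisfying $K=-K$. Suppose that $y_0^*\in\mathrm{dom}(F^* )$, and that the problem $$\text{(Dual)}\qquad\sup_{x\in K}\ \langle x,y_0^*\rangle-F(x)$$ has a solution $x_0$. Consider also the problem $$\text{(Primal)}\qquad\min_{x^*\in X^*}\ F^*(x^* )+1_K^*(x^*-y_0^* ).$$ Then a. (Primal) has a unique solution $x_0^*$, given by the single element of $\partial F(x_0)$; b. $x_0^*$ is also a solution to $$\min_{x^*:\ \partial F^*(x^* )\cap K\neq\emptyset}\ D(y_0^*,x^* );$$ c. the values of (Primal), (Dual), and $F^*(y_0^* )-D(y_0^*,x_0^* )$ coincide. Moreover, the following dichotomy holds: 1. If $\partial F^*(y_0^* )\cap K\neq\emptyset$, then $x_0^*=y_0^*$. 2. Otherwise, $x_0^*\neq y_0^*$, and any solution $x_0$ to (Dual) satisfies $x_0\in\partial F^*(x_0^* )$, $\|x_0\|_K=1$, and $$\langle x_0,y_0^*-x_0^*\rangle=1_K^*(x_0^*-y_0^* ).$$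
   Context: $\langle\cdot,\cdot\rangle$ is the duality pairing between $X$ and $X^*$. The Legendre dual is $F^*(x^* )=\sup_{x\in X}\langle x,x^*\rangle-F(x)\in\mathbb{R}\cup\{+\infty\}$, and $\mathrm{dom}(F^* )=\{x^*\in X^*\mid F^*(x^* )<+\infty\}$. $1_K$ is the convex indicator function of $K$ ($0$ on $K$, $+\infty$ off $K$), so $1_K^*(x^* )=\sup_{x\in K}\langle x,x^*\rangle$. The subdifferential of $F^*$ is taken in $X$: $\partial F^*(x^* )=\{x\in X\mid\forall y^*\in X^*,\ F^*(y^* )\ge F^*(x^* )+\langle x,y^*-x^*\rangle\}$; and $\partial F(x)\subset X^*$ is the usual subdifferential. The divergence $D:\mathrm{dom}(F^* )\times\mathrm{dom}(F^* )\to\mathbb{R}\cup\{+\infty\}$ is $$D(y^*,x^* )=F^*(y^* )-F^*(x^* )-\sup_{x\in\partial F^*(x^* )\cap K}\langle x,y^*-x^*\rangle,$$ with $\sup\emptyset=-\infty$. Finally $\|x\|_K=\inf\{t>0\mid x/t\in K\}\in[0,+\infty]$.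
   Formalization: In case 2, ‖x₀‖_K=1 is claimed only if 1_K^*(x₀^*−y₀^* )≠0 (automatic when span K is dense); unguarded it is false: X=ℝ, F(x)=x²/2, K={0}, y₀^*=1 gives x₀=0, ‖x₀‖_K=0. *)

theory Defs
  imports "HOL-Analysis.Analysis"
begin

section \<open>Locally convex spaces and their continuous duals\<close>

text \<open>Real Hausdorff locally convex topological vector spaces. Continuity of addition and
  negation comes from \<^class>\<open>topological_ab_group_add\<close>; local convexity is required at the
  origin, which by translation gives it everywhere. It is spelled out because \<^const>\<open>convex\<close>
  cannot be used inside a class specification.\<close>

class locally_convex_space = real_vector + topological_ab_group_add + t2_space +
  assumes tendsto_scaleR_nhds_Pair:
    "LIM p (nhds (r::real) \<times>\<^sub>F nhds x). fst p *\<^sub>R snd p :> nhds (r *\<^sub>R x)"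
  and locally_convex_zero:
    "open U \<Longrightarrow> 0 \<in> U \<Longrightarrow> \<exists>V. open V \<and> 0 \<in> V \<and> V \<subseteq> U \<and>
       (\<forall>x\<in>V. \<forall>y\<in>V. \<forall>u\<ge>0. \<forall>v\<ge>0. u + v = 1 \<longrightarrow> u *\<^sub>R x + v *\<^sub>R y \<in> V)"

lemma convex_nhd_zero:
  fixes U :: "'a::locally_convex_space set"
  assumes "open U" "0 \<in> U"
  obtains V where "open V" "convex V" "0 \<in> V" "V \<subseteq> U"
  using locally_convex_zero[OF assms] unfolding convex_def by metis

instance real_normed_vector \<subseteq> locally_convex_space
proof
  fix r :: real and x :: 'a
  show "LIM p (nhds r \<times>\<^sub>F nhds x). fst p *\<^sub>R snd p :> nhds (r *\<^sub>R x)"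
    by (intro tendsto_scaleR filterlim_fst filterlim_snd)
next
  fix U :: "'a set"
  assume "open U" "0 \<in> U"
  then obtain e where "e > 0" "ball 0 e \<subseteq> U"
    by (auto simp: open_contains_ball)
  moreover have "convex (ball (0::'a) e)"
    by simp
  ultimately show "\<exists>V. open V \<and> 0 \<in> V \<and> V \<subseteq> U \<and>
      (\<forall>x\<in>V. \<forall>y\<in>V. \<forall>u\<ge>0. \<forall>v\<ge>0. u + v = 1 \<longrightarrow> u *\<^sub>R x + v *\<^sub>R y \<in> V)"
    unfolding convex_def by (intro exI[of _ "ball 0 e"]) auto
qed

lemma continuous_on_scaleR_lcs:
  fixes f :: "'b::topological_space \<Rightarrow> real" and g :: "'b \<Rightarrow> 'a::locally_convex_space"
  assumes "continuous_on S f" "continuous_on S g"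
  shows "continuous_on S (\<lambda>x. f x *\<^sub>R g x)"
  unfolding continuous_on_def
proof
  fix x assume "x \<in> S"
  then have "(f \<longlongrightarrow> f x) (at x within S)" "(g \<longlongrightarrow> g x) (at x within S)"
    using assms by (auto simp: continuous_on_def)
  then have "filterlim (\<lambda>y. (f y, g y)) (nhds (f x) \<times>\<^sub>F nhds (g x)) (at x within S)"
    by (rule filterlim_Pair)
  from filterlim_compose[OF tendsto_scaleR_nhds_Pair this]
  show "((\<lambda>y. f y *\<^sub>R g y) \<longlongrightarrow> f x *\<^sub>R g x) (at x within S)"
    by simp
qed

typedef (overloaded) 'a topdual =
  "{f :: 'a::locally_convex_space \<Rightarrow> real. linear f \<and> continuous_on UNIV f}"
  morphisms apply_dual Abs_topdual
  by (rule exI[of _ "\<lambda>_. 0"]) (auto simp: linear_iff)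

setup_lifting type_definition_topdual

lemma topdual_eqI: "(\<And>x. apply_dual f x = apply_dual g x) \<Longrightarrow> f = g"
  by transfer auto

lemma linear_apply_dual: "linear (apply_dual f)"
  and continuous_on_apply_dual: "continuous_on UNIV (apply_dual f)"
  using apply_dual[of f] by auto

instantiation topdual :: (locally_convex_space) real_vector
begin

lift_definition zero_topdual :: "'a topdual" is "\<lambda>_. 0"
  by (auto simp: linear_iff)

lift_definition plus_topdual :: "'a topdual \<Rightarrow> 'a topdual \<Rightarrow> 'a topdual" is "\<lambda>f g x. f x + g x"
  by (auto intro: linear_compose_add continuous_on_add)

lift_definition minus_topdual :: "'a topdual \<Rightarrow> 'a topdual \<Rightarrow> 'a topdual" is "\<lambda>f g x. f x - g x"
  by (auto intro: linear_compose_sub continuous_on_diff)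

lift_definition uminus_topdual :: "'a topdual \<Rightarrow> 'a topdual" is "\<lambda>f x. - f x"
  by (auto intro: linear_compose_neg continuous_on_minus)

lift_definition scaleR_topdual :: "real \<Rightarrow> 'a topdual \<Rightarrow> 'a topdual" is "\<lambda>c f x. c * f x"
  by (auto simp: linear_iff algebra_simps intro!: continuous_on_mult_left)

instance
  by standard (transfer; auto simp: algebra_simps)+

end

definition pairing :: "'a::locally_convex_space \<Rightarrow> 'a topdual \<Rightarrow> real"  (\<open>\<langle>_, _\<rangle>\<close>)
  where "\<langle>x, xs\<rangle> = apply_dual xs x"

section \<open>Convex duality\<close>

text \<open>Functionals on the dual take values in \<^typ>\<open>ereal\<close>. The conjugate is defined for
  extended-real functions so that it applies to convex indicators too; a finite function
  \<open>F :: 'a \<Rightarrow> real\<close> enters as \<open>ereal \<circ> F\<close>.\<close>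

definition legendre :: "('a::locally_convex_space \<Rightarrow> ereal) \<Rightarrow> 'a topdual \<Rightarrow> ereal"
  where "legendre f xs = (SUP x. ereal \<langle>x, xs\<rangle> - f x)"

definition effective_dom :: "('b \<Rightarrow> ereal) \<Rightarrow> 'b set"
  where "effective_dom g = {y. g y < \<infinity>}"

text \<open>As usual for extended-real functions, the strict inequality is demanded only between
  distinct points of the effective domain.\<close>

definition strictly_convex :: "('b::real_vector \<Rightarrow> ereal) \<Rightarrow> bool"
  where "strictly_convex g \<longleftrightarrow>
    (\<forall>x \<in> effective_dom g. \<forall>y \<in> effective_dom g. \<forall>t. x \<noteq> y \<and> 0 < t \<and> t < 1 \<longrightarrow>
       g ((1 - t) *\<^sub>R x + t *\<^sub>R y) < ereal (1 - t) * g x + ereal t * g y)"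

definition convex_indicator :: "'b set \<Rightarrow> 'b \<Rightarrow> ereal"
  where "convex_indicator K x = (if x \<in> K then 0 else \<infinity>)"

lemma legendre_convex_indicator:
  "legendre (convex_indicator K) xs = (SUP x\<in>K. ereal \<langle>x, xs\<rangle>)"
proof (rule antisym)
  show "legendre (convex_indicator K) xs \<le> (SUP x\<in>K. ereal \<langle>x, xs\<rangle>)"
    unfolding legendre_def convex_indicator_def
    by (rule SUP_least) (auto intro: SUP_upper)
  show "(SUP x\<in>K. ereal \<langle>x, xs\<rangle>) \<le> legendre (convex_indicator K) xs"
    unfolding legendre_def
    by (rule SUP_mono) (auto simp: convex_indicator_def intro: exI[of _ "_ :: 'a"])
qed

definition subdifferential :: "('a::locally_convex_space \<Rightarrow> real) \<Rightarrow> 'a \<Rightarrow> 'a topdual set"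
  where "subdifferential F x = {xs. \<forall>y. F y \<ge> F x + \<langle>y - x, xs\<rangle>}"

text \<open>The subdifferential of a functional on the dual, taken in the predual.\<close>

definition predual_subdifferential ::
    "('a::locally_convex_space topdual \<Rightarrow> ereal) \<Rightarrow> 'a topdual \<Rightarrow> 'a set"
  where "predual_subdifferential G xs = {x. \<forall>ys. G ys \<ge> G xs + ereal \<langle>x, ys - xs\<rangle>}"

text \<open>Only meaningful for \<open>ys\<close> and \<open>xs\<close> in the effective domain of \<open>legendre (ereal \<circ> F)\<close>.
  There, the supremum over the empty set is \<open>-\<infinity>\<close> in \<^typ>\<open>ereal\<close>, so that the
  divergence is \<open>\<infinity>\<close> when the subdifferential at \<open>xs\<close> misses \<open>K\<close>.\<close>

definition divergence ::
    "('a::locally_convex_space \<Rightarrow> real) \<Rightarrow> 'a set \<Rightarrow> 'a topdual \<Rightarrow> 'a topdual \<Rightarrow> ereal"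
  where "divergence F K ys xs =
    legendre (ereal \<circ> F) ys - legendre (ereal \<circ> F) xs
      - (SUP x \<in> predual_subdifferential (legendre (ereal \<circ> F)) xs \<inter> K. ereal \<langle>x, ys - xs\<rangle>)"

text \<open>The infimum over the empty set is \<open>\<infinity>\<close>. When \<open>K\<close> does not span a dense subspace, the
  gauge of a maximizer of the dual problem may be less than \<open>1\<close> even if the subdifferential of
  the conjugate at \<open>ys\<close> misses \<open>K\<close>: take \<open>F x = x\<^sup>2 / 2\<close> on the reals, \<open>K = {0}\<close> and
  \<open>ys\<close> the identity. The maximizer is \<open>0\<close>, of gauge \<open>0\<close>. This is why the theorem asserts gauge \<open>1\<close>
  under the condition that the support function of \<open>K\<close> does not vanish at \<open>xs - ys\<close>, where \<open>xs\<close> is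
  the primal solution; if \<open>K\<close> spans a dense subspace, this holds as soon as \<open>xs \<noteq> ys\<close>.\<close>

definition gauge_functional :: "'a::real_vector set \<Rightarrow> 'a \<Rightarrow> ereal"
  where "gauge_functional K x = (INF t \<in> {t::real. 0 < t \<and> x /\<^sub>R t \<in> K}. ereal t)"

definition primal_objective ::
    "('a::locally_convex_space \<Rightarrow> real) \<Rightarrow> 'a set \<Rightarrow> 'a topdual \<Rightarrow> 'a topdual \<Rightarrow> ereal"
  where "primal_objective F K ys xs =
    legendre (ereal \<circ> F) xs + legendre (convex_indicator K) (xs - ys)"

definition dual_objective ::
    "('a::locally_convex_space \<Rightarrow> real) \<Rightarrow> 'a topdual \<Rightarrow> 'a \<Rightarrow> real"
  where "dual_objective F ys x = \<langle>x, ys\<rangle> - F x"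

end

theory Submission
  imports Defs
begin

text \<open>
  Let \<open>d\<close> be the maximum of \<open>\<langle>x, y0s\<rangle> - F x\<close> over \<open>K\<close>, attained at \<open>x0\<close>. Two inequalities bound
  the primal objective at \<open>xs\<close> from below: the Fenchel-Young inequality for \<open>F\<close> at the pair
  \<open>(x0, xs)\<close>, and the bound of the support function of \<open>K\<close> at \<open>xs - y0s\<close> by its value at
  \<open>- x0\<close>, a point of \<open>K\<close> by symmetry. The sum of the two lower bounds is exactly \<open>d\<close>. Hence the
  primal value is at least \<open>d\<close>, and \<open>xs\<close> attains \<open>d\<close> if and only if both inequalities are
  equalities: \<open>xs\<close> is a subgradient of \<open>F\<close> at \<open>x0\<close>, and \<open>x0\<close> maximizes \<open>y0s - xs\<close> over \<open>K\<close>
  (\<open>duality_gap_zero_iff\<close>).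

  That such a subgradient exists is the optimality condition for \<open>x0\<close>
  (\<open>optimal_subgradient_exists\<close>). It is a Hahn-Banach statement and the analytic core of the
  proof. Purely algebraically, a convex function vanishing at the origin dominates a linear one,
  because a minimal convex function below it is linear. Applied to the infimal convolution of
  \<open>F - y0s\<close> with the indicator of \<open>- K\<close>, this gives one linear functional that supports \<open>F - y0s\<close>
  at \<open>x0\<close> and is minimal over \<open>K\<close> there. It is continuous because the continuous function \<open>F\<close>
  dominates it up to a continuous affine term. Strict convexity of the conjugate makes the
  subgradient at \<open>x0\<close> unique, since the conjugate would be affine on the segment between two of
  them. So the primal solution is unique.

  The remaining claims are instances of the same equality conditions. Subgradients of the conjugate
  taken in the predual correspond to subgradients of \<open>F\<close> (\<open>predual_subdifferential_iff\<close>), so at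
  a point \<open>xs\<close> whose predual subdifferential meets \<open>K\<close>, the conjugate at \<open>y0s\<close> minus the divergence is the
  supremum of the dual objective over a subset of \<open>K\<close>. It is therefore at most \<open>d\<close>, and equals
  \<open>d\<close> when that subset contains \<open>x0\<close>. If a subgradient of the conjugate at \<open>y0s\<close> lies in \<open>K\<close>,
  then \<open>y0s\<close> itself closes the duality gap. Otherwise each dual solution closes the gap with the
  primal solution, so it maximizes a linear functional over \<open>K\<close>; if the maximum is positive, no
  larger multiple of the solution can stay in \<open>K\<close>, which forces the gauge to be \<open>1\<close>.
\<close>

section \<open>Linear minorants of convex functions\<close>

text \<open>The assumption on convex combinations covers the two kinds of infima used below: over a chain
  of convex functions (\<open>k\<close> is the smaller of \<open>i\<close> and \<open>j\<close>) and over one argument of a jointly convex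
  function (\<open>k\<close> is the same convex combination of \<open>i\<close> and \<open>j\<close>).\<close>

lemma convex_on_INF:
  fixes f :: "'i \<Rightarrow> 'a::real_vector \<Rightarrow> real"
  assumes nonempty: "I \<noteq> {}"
    and bdd: "\<And>x. bdd_below ((\<lambda>i. f i x) ` I)"
    and mix: "\<And>i j x y u v. \<lbrakk>i \<in> I; j \<in> I; 0 \<le> u; 0 \<le> v; u + v = 1\<rbrakk> \<Longrightarrow>
      \<exists>k\<in>I. f k (u *\<^sub>R x + v *\<^sub>R y) \<le> u * f i x + v * f j y"
  shows "convex_on UNIV (\<lambda>x. INF i\<in>I. f i x)"
  unfolding convex_on_def
proof (intro conjI ballI allI impI)
  fix x y :: 'a and u v :: real
  assume uv: "0 \<le> u" "0 \<le> v" "u + v = 1"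
  show "(INF i\<in>I. f i (u *\<^sub>R x + v *\<^sub>R y)) \<le> u * (INF i\<in>I. f i x) + v * (INF i\<in>I. f i y)"
  proof (rule field_le_epsilon)
    fix e :: real
    assume "0 < e"
    have approx: "\<exists>i\<in>I. f i z < (INF i\<in>I. f i z) + e" for z
      using cINF_less_iff[OF nonempty bdd, of z "(INF i\<in>I. f i z) + e"] \<open>0 < e\<close> by simp
    obtain i where i: "i \<in> I" "f i x < (INF i\<in>I. f i x) + e" using approx by blast
    obtain j where j: "j \<in> I" "f j y < (INF i\<in>I. f i y) + e" using approx by blast
    obtain k where k: "k \<in> I" "f k (u *\<^sub>R x + v *\<^sub>R y) \<le> u * f i x + v * f j y"
      using mix[OF i(1) j(1) uv] by blast
    have "(INF i\<in>I. f i (u *\<^sub>R x + v *\<^sub>R y)) \<le> f k (u *\<^sub>R x + v *\<^sub>R y)"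
      using k(1) by (intro cINF_lower bdd)
    also note k(2)
    also have "u * f i x + v * f j y \<le> u * ((INF i\<in>I. f i x) + e) + v * ((INF i\<in>I. f i y) + e)"
      using i j uv by (intro add_mono mult_left_mono) auto
    also have "\<dots> = u * (INF i\<in>I. f i x) + v * (INF i\<in>I. f i y) + (u + v) * e"
      by (simp add: algebra_simps)
    finally show "(INF i\<in>I. f i (u *\<^sub>R x + v *\<^sub>R y)) \<le>
        u * (INF i\<in>I. f i x) + v * (INF i\<in>I. f i y) + e"
      using uv by simp
  qed
qed simp

lemma convex_on_ge_neg_reflection:
  assumes "convex_on UNIV q" "q (0::'a::real_vector) = 0"
  shows "- q (- v) \<le> q v"
proof -
  have "q ((1 - 1/2) *\<^sub>R (- v) + (1/2) *\<^sub>R v) \<le> (1 - 1/2) * q (- v) + (1/2) * q v"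
    by (rule convex_onD[OF assms(1)]) auto
  then show ?thesis using assms(2) by (simp add: algebra_simps)
qed

text \<open>The reason that Zorn's lemma applies is that every convex \<open>q \<le> g\<close> with \<open>q 0 = 0\<close> also
  satisfies \<open>q v \<ge> - q (- v) \<ge> - g (- v)\<close>, so that infima of chains remain finite. Minimal
  functions take over the role of maximal extensions in the usual proof of the Hahn-Banach
  theorem, which avoids functionals defined on subspaces.\<close>

lemma convex_on_minimal_below:
  fixes g :: "'a::real_vector \<Rightarrow> real"
  assumes "convex_on UNIV g" "g 0 = 0"
  obtains q where "convex_on UNIV q" "q 0 = 0" "q \<le> g"
    "\<And>p. \<lbrakk>convex_on UNIV p; p 0 = 0; p \<le> q\<rbrakk> \<Longrightarrow> p = q"
proof -
  define A where "A = {q. convex_on UNIV q \<and> q 0 = 0 \<and> q \<le> g}"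
  have "\<exists>m\<in>A. \<forall>a\<in>A. a \<le> m \<longrightarrow> a = m"
  proof (rule predicate_Zorn)
    show "partial_order_on A (relation_of (\<lambda>p q. q \<le> p) A)"
      by (rule partial_order_on_relation_ofI) auto
  next
    fix C
    assume C: "C \<in> Chains (relation_of (\<lambda>p q. q \<le> p) A)"
    show "\<exists>u\<in>A. \<forall>a\<in>C. u \<le> a"
    proof (cases "C = {}")
      case True
      then show ?thesis using assms by (auto simp: A_def)
    next
      case False
      have CA: "C \<subseteq> A" and total: "\<And>p q. p \<in> C \<Longrightarrow> q \<in> C \<Longrightarrow> p \<le> q \<or> q \<le> p"
        using C unfolding Chains_def relation_of_def by blast+
      define c where "c v = (INF q\<in>C. q v)" for v
      have bdd: "bdd_below ((\<lambda>q. q v) ` C)" for v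
      proof (rule bdd_belowI2)
        fix q assume "q \<in> C"
        then have q: "convex_on UNIV q" "q 0 = 0" "q (- v) \<le> g (- v)"
          using CA by (auto simp: A_def le_fun_def)
        then show "- g (- v) \<le> q v"
          using convex_on_ge_neg_reflection[of q v] by linarith
      qed
      have below: "c \<le> q" if "q \<in> C" for q
        unfolding le_fun_def c_def using that by (auto intro: cINF_lower bdd)
      have "convex_on UNIV c"
        unfolding c_def
      proof (rule convex_on_INF[OF False bdd])
        fix p q :: "'a \<Rightarrow> real" and x y :: 'a and u v :: real
        assume pq: "p \<in> C" "q \<in> C" and uv: "0 \<le> u" "0 \<le> v" "u + v = 1"
        obtain r where r: "r \<in> C" "r \<le> p" "r \<le> q" using total pq by blast
        then have "convex_on UNIV r" using CA by (auto simp: A_def)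
        then have "r (u *\<^sub>R x + v *\<^sub>R y) \<le> u * r x + v * r y"
          using uv by (auto simp: convex_on_def)
        also have "\<dots> \<le> u * p x + v * q y"
          using r uv by (intro add_mono mult_left_mono) (auto simp: le_fun_def)
        finally show "\<exists>k\<in>C. k (u *\<^sub>R x + v *\<^sub>R y) \<le> u * p x + v * q y" using r(1) by blast
      qed
      moreover have "c 0 = 0"
      proof -
        have "c 0 = (INF q\<in>C. 0::real)"
          unfolding c_def using CA by (intro INF_cong) (auto simp: A_def)
        then show ?thesis using False by simp
      qed
      moreover have "c \<le> g"
      proof -
        obtain q where "q \<in> C" using False by blast
        then show ?thesis using below[of q] CA by (auto simp: A_def)
      qed
      ultimately show ?thesis using below by (auto simp: A_def)
    qed
  qed
  then obtain m where m: "m \<in> A" "\<And>a. a \<in> A \<Longrightarrow> a \<le> m \<Longrightarrow> a = m" by blast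
  show thesis
  proof (rule that[of m])
    fix p assume "convex_on UNIV p" "p 0 = 0" "p \<le> m"
    then show "p = m" using m by (auto simp: A_def)
  qed (use m(1) in \<open>auto simp: A_def\<close>)
qed

text \<open>Two constructions would produce a smaller convex function. The rescaled functions
  \<open>v \<mapsto> q (t v) / t\<close> with \<open>t \<le> 1\<close> lie below \<open>q\<close>, so minimality makes \<open>q\<close> positively homogeneous
  and then, by convexity, subadditive. Shifting by multiples of \<open>w\<close> at the cost \<open>q w\<close> gives
  \<open>v \<mapsto> inf {q (v + t w) - t q w | t \<ge> 0}\<close>, and minimality with \<open>t = 1\<close> makes \<open>q\<close>
  superadditive.\<close>

lemma linear_if_minimal_convex:
  fixes q :: "'a::real_vector \<Rightarrow> real"
  assumes conv: "convex_on UNIV q" and zero: "q 0 = 0"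
    and minimal: "\<And>p. \<lbrakk>convex_on UNIV p; p 0 = 0; p \<le> q\<rbrakk> \<Longrightarrow> p = q"
  shows "linear q"
proof -
  have shrink: "q (t *\<^sub>R v) = t * q v" if t: "0 < t" "t \<le> 1" for t v
  proof -
    have "convex_on UNIV (\<lambda>v. q (t *\<^sub>R v) / t)"
      unfolding convex_on_def
    proof (intro conjI ballI allI impI)
      fix x y :: 'a and a b :: real
      assume ab: "0 \<le> a" "0 \<le> b" "a + b = 1"
      have "q (a *\<^sub>R (t *\<^sub>R x) + b *\<^sub>R (t *\<^sub>R y)) \<le> a * q (t *\<^sub>R x) + b * q (t *\<^sub>R y)"
        using conv ab unfolding convex_on_def by blast
      moreover have "a *\<^sub>R (t *\<^sub>R x) + b *\<^sub>R (t *\<^sub>R y) = t *\<^sub>R (a *\<^sub>R x + b *\<^sub>R y)"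
        by (simp add: algebra_simps)
      ultimately show "q (t *\<^sub>R (a *\<^sub>R x + b *\<^sub>R y)) / t \<le>
          a * (q (t *\<^sub>R x) / t) + b * (q (t *\<^sub>R y) / t)"
        using t by (simp add: field_simps)
    qed simp
    moreover have "(\<lambda>v. q (t *\<^sub>R v) / t) \<le> q"
      unfolding le_fun_def
    proof
      fix w
      have "q ((1 - t) *\<^sub>R 0 + t *\<^sub>R w) \<le> (1 - t) * q 0 + t * q w"
        using t by (intro convex_onD[OF conv]) auto
      then show "q (t *\<^sub>R w) / t \<le> q w"
        using t zero by (simp add: field_simps)
    qed
    ultimately have "(\<lambda>v. q (t *\<^sub>R v) / t) = q"
      using zero by (intro minimal) auto
    then show ?thesis using t by (metis less_irrefl nonzero_eq_divide_eq mult.commute)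
  qed
  have pos_hom: "q (t *\<^sub>R v) = t * q v" if "0 < t" for t v
  proof (cases "t \<le> 1")
    case False
    then show ?thesis using shrink[of "1 / t" "t *\<^sub>R v"] by (simp add: field_simps)
  qed (use shrink that in auto)
  have subadd: "q (v + w) \<le> q v + q w" for v w
  proof -
    have "q ((1 - 1/2) *\<^sub>R v + (1/2) *\<^sub>R w) \<le> (1 - 1/2) * q v + (1/2) * q w"
      by (rule convex_onD[OF conv]) auto
    moreover have "(1 - 1/2) *\<^sub>R v + (1/2) *\<^sub>R w = (1/2) *\<^sub>R (v + w)"
      by (simp add: algebra_simps)
    ultimately show ?thesis using pos_hom[of "1/2" "v + w"] by simp
  qed
  have superadd: "q v + q w \<le> q (v + w)" for v w
  proof -
    define f where "f t v = q (v + t *\<^sub>R w) - t * q w" for t v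
    define p where "p v = (INF t\<in>{0..}. f t v)" for v
    have hom: "q (t *\<^sub>R w) = t * q w" if "0 \<le> t" for t
      using that pos_hom[of t w] zero by (cases "t = 0") auto
    have bdd: "bdd_below ((\<lambda>t. f t v) ` {0..})" for v
    proof (rule bdd_belowI2)
      fix t :: real assume "t \<in> {0..}"
      then show "- q (- v) \<le> f t v"
        using subadd[of "v + t *\<^sub>R w" "- v"] hom[of t] by (simp add: f_def)
    qed
    have below: "p v \<le> f t v" if "0 \<le> t" for t v
      unfolding p_def using that by (intro cINF_lower bdd) auto
    have "convex_on UNIV p"
      unfolding p_def
    proof (rule convex_on_INF[OF _ bdd])
      fix s t a b :: real and x y :: 'a
      assume st: "s \<in> {0..}" "t \<in> {0..}" and ab: "0 \<le> a" "0 \<le> b" "a + b = 1"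
      have "q (a *\<^sub>R (x + s *\<^sub>R w) + b *\<^sub>R (y + t *\<^sub>R w)) \<le>
          a * q (x + s *\<^sub>R w) + b * q (y + t *\<^sub>R w)"
        using conv ab unfolding convex_on_def by blast
      then have "f (a * s + b * t) (a *\<^sub>R x + b *\<^sub>R y) \<le> a * f s x + b * f t y"
        by (simp add: f_def algebra_simps)
      moreover have "a * s + b * t \<in> {0..}" using st ab by simp
      ultimately show "\<exists>k\<in>{0..}. f k (a *\<^sub>R x + b *\<^sub>R y) \<le> a * f s x + b * f t y" by blast
    qed simp
    moreover have "p 0 = 0"
    proof -
      have "(\<lambda>t. f t 0) ` {0..} = {0}" using hom by (force simp: f_def)
      then show ?thesis by (simp add: p_def)
    qed
    moreover have "p \<le> q"
      using below[of 0] by (simp add: le_fun_def f_def)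
    ultimately have "p = q" by (rule minimal)
    then show ?thesis using below[of 1 v] by (simp add: f_def)
  qed
  have add: "q (v + w) = q v + q w" for v w
    using subadd superadd by (rule antisym)
  have neg: "q (- v) = - q v" for v
    using add[of v "- v"] zero by simp
  have "q (t *\<^sub>R v) = t * q v" for t v
  proof (cases "0 < t")
    case False
    then consider "t = 0" | "0 < - t" by linarith
    then show ?thesis
    proof cases
      case 2
      then show ?thesis using pos_hom[of "- t" v] neg[of "t *\<^sub>R v"] by simp
    qed (simp add: zero)
  qed (rule pos_hom)
  with add show ?thesis by (simp add: linear_iff)
qed

theorem convex_on_linear_minorant:
  fixes g :: "'a::real_vector \<Rightarrow> real"
  assumes "convex_on UNIV g" "g 0 = 0"
  obtains l where "linear l" "\<And>v. l v \<le> g v"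
proof -
  obtain q where q: "convex_on UNIV q" "q 0 = 0" "q \<le> g"
      "\<And>p. \<lbrakk>convex_on UNIV p; p 0 = 0; p \<le> q\<rbrakk> \<Longrightarrow> p = q"
    using convex_on_minimal_below[OF assms] by blast
  show thesis
  proof (rule that)
    show "linear q" using q(1,2,4) by (rule linear_if_minimal_convex)
    show "q v \<le> g v" for v using q(3) by (simp add: le_fun_def)
  qed
qed

text \<open>The function \<open>g v = inf {h (k + v) - h a | k \<in> K}\<close> is convex and vanishes at \<open>0\<close> by
  minimality of \<open>a\<close>; it is finite since \<open>h (k + v)\<close> and \<open>h (a - v)\<close> average to at least the value
  of \<open>h\<close> at the midpoint of \<open>k\<close> and \<open>a\<close>, a point of \<open>K\<close>. Any linear minorant of \<open>g\<close> serves.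
  The conclusion packs two facts: \<open>k = a\<close> says that \<open>l\<close> is a subgradient of \<open>h\<close> at \<open>a\<close>, and
  \<open>x = a\<close> says that \<open>l\<close> attains its minimum over \<open>K\<close> at \<open>a\<close>.\<close>

theorem convex_minimizer_separation:
  fixes h :: "'a::real_vector \<Rightarrow> real"
  assumes h: "convex_on UNIV h" and K: "convex K" and a: "a \<in> K"
    and min: "\<And>k. k \<in> K \<Longrightarrow> h a \<le> h k"
  obtains l where "linear l" "\<And>x k. k \<in> K \<Longrightarrow> l (x - k) \<le> h x - h a"
proof -
  define f where "f k v = h (k + v) - h a" for k v
  define g where "g v = (INF k\<in>K. f k v)" for v
  have bdd: "bdd_below ((\<lambda>k. f k v) ` K)" for v
  proof (rule bdd_belowI2)
    fix k assume k: "k \<in> K"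
    have mid: "(1 - 1/2) *\<^sub>R k + (1/2) *\<^sub>R a \<in> K"
      using K k a by (intro convexD_alt) auto
    have "h ((1 - 1/2) *\<^sub>R (k + v) + (1/2) *\<^sub>R (a - v)) \<le>
        (1 - 1/2) * h (k + v) + (1/2) * h (a - v)"
      by (rule convex_onD[OF h]) auto
    moreover have "(1 - 1/2) *\<^sub>R (k + v) + (1/2) *\<^sub>R (a - v) = (1 - 1/2) *\<^sub>R k + (1/2) *\<^sub>R a"
      by (simp add: algebra_simps)
    ultimately show "h a - h (a - v) \<le> f k v"
      using min[OF mid] by (simp add: f_def)
  qed
  have "convex_on UNIV g"
    unfolding g_def
  proof (rule convex_on_INF[OF _ bdd])
    fix k m x y and s t :: real
    assume km: "k \<in> K" "m \<in> K" and st: "0 \<le> s" "0 \<le> t" "s + t = 1"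
    have "h (s *\<^sub>R (k + x) + t *\<^sub>R (m + y)) \<le> s * h (k + x) + t * h (m + y)"
      using h st unfolding convex_on_def by blast
    moreover have "s * (h (k + x) - h a) + t * (h (m + y) - h a) =
        s * h (k + x) + t * h (m + y) - (s + t) * h a"
      by (simp add: algebra_simps)
    ultimately have "f (s *\<^sub>R k + t *\<^sub>R m) (s *\<^sub>R x + t *\<^sub>R y) \<le> s * f k x + t * f m y"
      using st by (simp add: f_def algebra_simps)
    moreover have "s *\<^sub>R k + t *\<^sub>R m \<in> K" using K km st by (rule convexD)
    ultimately show "\<exists>j\<in>K. f j (s *\<^sub>R x + t *\<^sub>R y) \<le> s * f k x + t * f m y" by blast
  qed (use a in auto)
  moreover have "g 0 = 0"
  proof (rule antisym)
    show "g 0 \<le> 0" unfolding g_def using cINF_lower[OF bdd a, of 0] by (simp add: f_def)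
    show "0 \<le> g 0" unfolding g_def using a min by (intro cINF_greatest) (auto simp: f_def)
  qed
  ultimately obtain l where l: "linear l" "\<And>v. l v \<le> g v"
    using convex_on_linear_minorant by blast
  show thesis
  proof (rule that[OF l(1)])
    fix x k assume k: "k \<in> K"
    have "l (x - k) \<le> g (x - k)" by (rule l(2))
    also have "\<dots> \<le> f k (x - k)" unfolding g_def using k by (intro cINF_lower bdd)
    finally show "l (x - k) \<le> h x - h a" by (simp add: f_def)
  qed
qed


section \<open>Subgradients of continuous convex functions\<close>

lemma pairing_simps:
  "\<langle>- x, xs\<rangle> = - \<langle>x, xs\<rangle>" "\<langle>x - y, xs\<rangle> = \<langle>x, xs\<rangle> - \<langle>y, xs\<rangle>"
  "\<langle>t *\<^sub>R x, xs\<rangle> = t * \<langle>x, xs\<rangle>"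
  "\<langle>x, 0\<rangle> = 0" "\<langle>x, xs + ys\<rangle> = \<langle>x, xs\<rangle> + \<langle>x, ys\<rangle>" "\<langle>x, xs - ys\<rangle> = \<langle>x, xs\<rangle> - \<langle>x, ys\<rangle>"
  "\<langle>x, - xs\<rangle> = - \<langle>x, xs\<rangle>" "\<langle>x, t *\<^sub>R xs\<rangle> = t * \<langle>x, xs\<rangle>"
  using linear_apply_dual[of xs]
  by (simp_all add: pairing_def linear_neg linear_diff linear_scale zero_topdual.rep_eq
      plus_topdual.rep_eq uminus_topdual.rep_eq minus_topdual.rep_eq scaleR_topdual.rep_eq)

text \<open>Domination at \<open>a + w\<close> and at \<open>a - w\<close> squeezes \<open>l w\<close> between two quantities that vanish as
  \<open>w\<close> tends to \<open>0\<close>, and by linearity continuity at the origin is continuity everywhere.\<close>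

lemma linear_continuous_if_dominated:
  fixes F :: "'a::locally_convex_space \<Rightarrow> real"
  assumes lin: "linear l" and F: "continuous_on UNIV F"
    and dom: "\<And>x. l (x - a) \<le> F x - F a"
  shows "continuous_on UNIV l"
  unfolding continuous_on_def
proof
  fix x
  have isCont: "isCont F a" using F by (simp add: continuous_on_eq_continuous_at)
  have upper: "((\<lambda>y. F (a + (y - x)) - F a) \<longlongrightarrow> 0) (at x)"
  proof -
    have "((\<lambda>y. a + (y - x)) \<longlongrightarrow> a + (x - x)) (at x)" by (intro tendsto_intros)
    then have "((\<lambda>y. F (a + (y - x))) \<longlongrightarrow> F a) (at x)"
      using isCont by (intro isCont_tendsto_compose[of a F]) auto
    then show ?thesis by (simp add: LIM_zero)
  qed
  have lower: "((\<lambda>y. - (F (a - (y - x)) - F a)) \<longlongrightarrow> 0) (at x)"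
  proof -
    have "((\<lambda>y. a - (y - x)) \<longlongrightarrow> a - (x - x)) (at x)" by (intro tendsto_intros)
    then have "((\<lambda>y. F (a - (y - x))) \<longlongrightarrow> F a) (at x)"
      using isCont by (intro isCont_tendsto_compose[of a F]) auto
    then show ?thesis using tendsto_minus[OF LIM_zero] by fastforce
  qed
  have "((\<lambda>y. l y - l x) \<longlongrightarrow> 0) (at x)"
  proof (rule tendsto_sandwich[OF _ _ lower upper]; intro always_eventually allI)
    fix y
    show "l y - l x \<le> F (a + (y - x)) - F a"
      using dom[of "a + (y - x)"] lin by (simp add: linear_diff)
    show "- (F (a - (y - x)) - F a) \<le> l y - l x"
      using dom[of "a - (y - x)"] lin by (simp add: linear_diff linear_neg)
  qed
  then show "(l \<longlongrightarrow> l x) (at x within UNIV)" by (simp add: LIM_zero_iff)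
qed

text \<open>The optimality condition for maximizing \<open>\<langle>x, ys\<rangle> - F x\<close> over a convex set: some
  subgradient \<open>xs\<close> of \<open>F\<close> at the maximizer leaves \<open>ys - xs\<close> in the normal cone of the set. It is
  \<open>ys\<close> plus the functional that \<open>convex_minimizer_separation\<close> gives for \<open>F - ys\<close>.\<close>

theorem optimal_subgradient_exists:
  fixes F :: "'a::locally_convex_space \<Rightarrow> real"
  assumes cont: "continuous_on UNIV F" and F: "convex_on UNIV F" and K: "convex K"
    and x0: "x0 \<in> K" and max: "\<And>k. k \<in> K \<Longrightarrow> dual_objective F ys k \<le> dual_objective F ys x0"
  obtains xs where "xs \<in> subdifferential F x0" "\<And>k. k \<in> K \<Longrightarrow> \<langle>k, ys - xs\<rangle> \<le> \<langle>x0, ys - xs\<rangle>"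
proof -
  define h where "h x = F x - \<langle>x, ys\<rangle>" for x
  have "convex_on UNIV h"
    unfolding convex_on_def
  proof (intro conjI ballI allI impI)
    fix x y :: 'a and u v :: real
    assume uv: "0 \<le> u" "0 \<le> v" "u + v = 1"
    have "F (u *\<^sub>R x + v *\<^sub>R y) \<le> u * F x + v * F y"
      using F uv unfolding convex_on_def by blast
    moreover have "\<langle>u *\<^sub>R x + v *\<^sub>R y, ys\<rangle> = u * \<langle>x, ys\<rangle> + v * \<langle>y, ys\<rangle>"
      using linear_apply_dual[of ys] by (simp add: pairing_def linear_add linear_scale)
    ultimately show "h (u *\<^sub>R x + v *\<^sub>R y) \<le> u * h x + v * h y"
      by (simp add: h_def algebra_simps)
  qed simp
  moreover have "h x0 \<le> h k" if "k \<in> K" for k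
    using max[OF that] by (simp add: h_def dual_objective_def)
  ultimately obtain l where l: "linear l" "\<And>x k. k \<in> K \<Longrightarrow> l (x - k) \<le> h x - h x0"
    using convex_minimizer_separation[OF _ K x0] by blast
  have "continuous_on UNIV h"
    unfolding h_def pairing_def by (intro continuous_on_diff cont continuous_on_apply_dual)
  then have "continuous_on UNIV l"
    using l x0 by (intro linear_continuous_if_dominated[of l h x0]) auto
  then obtain ls where ls: "apply_dual ls = l"
    using l(1) Abs_topdual_inverse[of l] by blast
  then have ls_eq: "\<langle>x, ls\<rangle> = l x" for x by (simp add: pairing_def)
  show thesis
  proof (rule that[of "ys + ls"])
    have "F x0 + \<langle>x - x0, ys + ls\<rangle> \<le> F x" for x
      using l(2)[OF x0, of x] by (simp add: h_def pairing_simps ls_eq linear_diff[OF l(1)])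
    then show "ys + ls \<in> subdifferential F x0" by (simp add: subdifferential_def)
    show "\<langle>k, ys - (ys + ls)\<rangle> \<le> \<langle>x0, ys - (ys + ls)\<rangle>" if "k \<in> K" for k
      using l(2)[OF that, of x0] by (simp add: pairing_simps ls_eq linear_diff[OF l(1)])
  qed
qed

text \<open>Every point is optimal for the constraint that admits only this point.\<close>

corollary subdifferential_nonempty:
  fixes F :: "'a::locally_convex_space \<Rightarrow> real"
  assumes "continuous_on UNIV F" "convex_on UNIV F"
  shows "subdifferential F x \<noteq> {}"
  using optimal_subgradient_exists[OF assms, of "{x}" x 0] by auto

section \<open>Equality in the Fenchel-Young inequality\<close>

lemma fenchel_young: "ereal (\<langle>x, xs\<rangle> - F x) \<le> legendre (ereal \<circ> F) xs"
  unfolding legendre_def by (rule SUP_upper2[of x]) auto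

lemma legendre_neq_MInf: "legendre (ereal \<circ> F) xs \<noteq> -\<infinity>"
  using fenchel_young[where F = F and x = 0 and xs = xs] by auto

lemma subdifferential_iff_fenchel_eq:
  "xs \<in> subdifferential F x \<longleftrightarrow> legendre (ereal \<circ> F) xs = ereal (\<langle>x, xs\<rangle> - F x)"
proof
  assume xs: "xs \<in> subdifferential F x"
  have "legendre (ereal \<circ> F) xs \<le> ereal (\<langle>x, xs\<rangle> - F x)"
    unfolding legendre_def
  proof (rule SUP_least)
    fix y
    have "F x + \<langle>y - x, xs\<rangle> \<le> F y" using xs by (simp add: subdifferential_def)
    then show "ereal \<langle>y, xs\<rangle> - (ereal \<circ> F) y \<le> ereal (\<langle>x, xs\<rangle> - F x)"
      by (simp add: pairing_simps)
  qed
  then show "legendre (ereal \<circ> F) xs = ereal (\<langle>x, xs\<rangle> - F x)"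
    using fenchel_young by (rule antisym)
next
  assume eq: "legendre (ereal \<circ> F) xs = ereal (\<langle>x, xs\<rangle> - F x)"
  have "F x + \<langle>y - x, xs\<rangle> \<le> F y" for y
    using fenchel_young[of y xs F] eq by (simp add: pairing_simps)
  then show "xs \<in> subdifferential F x" by (simp add: subdifferential_def)
qed

text \<open>Subgradients of the conjugate in the predual invert subgradients of \<open>F\<close>. Usually this is
  deduced from biconjugation; here it suffices to test the subgradient inequality of the conjugate
  at one subgradient of \<open>F\<close> at \<open>x\<close>, where the conjugate is known.\<close>

lemma predual_subdifferential_iff:
  fixes F :: "'a::locally_convex_space \<Rightarrow> real"
  assumes "continuous_on UNIV F" "convex_on UNIV F"
  shows "x \<in> predual_subdifferential (legendre (ereal \<circ> F)) xs \<longleftrightarrow> xs \<in> subdifferential F x"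
proof
  assume x: "x \<in> predual_subdifferential (legendre (ereal \<circ> F)) xs"
  obtain ys where "ys \<in> subdifferential F x" using subdifferential_nonempty[OF assms] by blast
  then have "legendre (ereal \<circ> F) ys = ereal (\<langle>x, ys\<rangle> - F x)"
    by (simp add: subdifferential_iff_fenchel_eq)
  moreover have "legendre (ereal \<circ> F) xs + ereal \<langle>x, ys - xs\<rangle> \<le> legendre (ereal \<circ> F) ys"
    using x by (simp add: predual_subdifferential_def)
  ultimately have "legendre (ereal \<circ> F) xs \<le> ereal (\<langle>x, xs\<rangle> - F x)"
    by (cases "legendre (ereal \<circ> F) xs") (auto simp: pairing_simps)
  then show "xs \<in> subdifferential F x"
    using fenchel_young[of x xs F] by (simp add: subdifferential_iff_fenchel_eq antisym)
next
  assume "xs \<in> subdifferential F x"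
  then have eq: "legendre (ereal \<circ> F) xs = ereal (\<langle>x, xs\<rangle> - F x)"
    by (simp add: subdifferential_iff_fenchel_eq)
  have "legendre (ereal \<circ> F) xs + ereal \<langle>x, ys - xs\<rangle> \<le> legendre (ereal \<circ> F) ys" for ys
    using fenchel_young[of x ys F] by (simp add: eq pairing_simps)
  then show "x \<in> predual_subdifferential (legendre (ereal \<circ> F)) xs"
    by (simp add: predual_subdifferential_def)
qed

text \<open>On the subgradients of \<open>F\<close> at \<open>x\<close> the conjugate agrees with the affine function
  \<open>xs \<mapsto> \<langle>x, xs\<rangle> - F x\<close>, which it dominates everywhere. Strict convexity would push it below that
  function at the midpoint of two distinct subgradients.\<close>

lemma subdifferential_unique:
  assumes strict: "strictly_convex (legendre (ereal \<circ> F))"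
    and xs: "xs \<in> subdifferential F x" and ys: "ys \<in> subdifferential F x"
  shows "xs = ys"
proof (rule ccontr)
  assume "xs \<noteq> ys"
  let ?m = "(1 - 1/2) *\<^sub>R xs + (1/2) *\<^sub>R ys"
  have eqs: "legendre (ereal \<circ> F) xs = ereal (\<langle>x, xs\<rangle> - F x)"
      "legendre (ereal \<circ> F) ys = ereal (\<langle>x, ys\<rangle> - F x)"
    using xs ys by (simp_all add: subdifferential_iff_fenchel_eq)
  then have "xs \<in> effective_dom (legendre (ereal \<circ> F))" "ys \<in> effective_dom (legendre (ereal \<circ> F))"
    by (simp_all add: effective_dom_def)
  moreover have "xs \<noteq> ys \<and> 0 < (1/2::real) \<and> (1/2::real) < 1" using \<open>xs \<noteq> ys\<close> by simp
  ultimately have "legendre (ereal \<circ> F) ?m <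
      ereal (1 - 1/2) * legendre (ereal \<circ> F) xs + ereal (1/2) * legendre (ereal \<circ> F) ys"
    using strict unfolding strictly_convex_def by blast
  also have "\<dots> = ereal (\<langle>x, ?m\<rangle> - F x)" by (simp add: eqs pairing_simps field_simps)
  also have "\<dots> \<le> legendre (ereal \<circ> F) ?m" by (rule fenchel_young)
  finally show False by simp
qed

section \<open>Duality for symmetric constraint sets\<close>

lemma pairing_le_support:
  assumes sym: "K = uminus ` K" and x: "x \<in> K"
  shows "ereal \<langle>x, ys - xs\<rangle> \<le> legendre (convex_indicator K) (xs - ys)"
proof -
  have "- x \<in> K" using sym x by blast
  then show ?thesis
    unfolding legendre_convex_indicator by (rule SUP_upper2) (simp add: pairing_simps)
qed

lemma support_le:
  assumes sym: "K = uminus ` K" and le: "\<And>k. k \<in> K \<Longrightarrow> \<langle>k, ys - xs\<rangle> \<le> c"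
  shows "legendre (convex_indicator K) (xs - ys) \<le> ereal c"
  unfolding legendre_convex_indicator
proof (rule SUP_least)
  fix k assume "k \<in> K"
  then have "- k \<in> K" using sym by blast
  from le[OF this] show "ereal \<langle>k, xs - ys\<rangle> \<le> ereal c" by (simp add: pairing_simps)
qed

lemma weak_duality:
  assumes sym: "K = uminus ` K" and x: "x \<in> K"
  shows "ereal (dual_objective F ys x) \<le> primal_objective F K ys xs"
proof -
  have "ereal (dual_objective F ys x) = ereal (\<langle>x, xs\<rangle> - F x) + ereal \<langle>x, ys - xs\<rangle>"
    by (simp add: dual_objective_def pairing_simps)
  also have "\<dots> \<le> primal_objective F K ys xs"
    unfolding primal_objective_def by (intro add_mono fenchel_young pairing_le_support assms)
  finally show ?thesis .
qed

text \<open>The objectives differ by the sum of the gaps in the Fenchel-Young inequality and in the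
  estimate of the support function at \<open>- x\<close>. Both gaps are nonnegative, so the sum vanishes only if
  each of them does.\<close>

lemma duality_gap_zero_iff:
  assumes sym: "K = uminus ` K" and x: "x \<in> K"
  shows "primal_objective F K ys xs = ereal (dual_objective F ys x) \<longleftrightarrow>
    xs \<in> subdifferential F x \<and> legendre (convex_indicator K) (xs - ys) = ereal \<langle>x, ys - xs\<rangle>"
  using fenchel_young[of x xs F] pairing_le_support[OF assms, of ys xs]
  unfolding subdifferential_iff_fenchel_eq primal_objective_def
  by (cases "legendre (ereal \<circ> F) xs"; cases "legendre (convex_indicator K) (xs - ys)")
    (auto simp: dual_objective_def pairing_simps)

text \<open>If \<open>x / t\<close> were in \<open>K\<close> for some \<open>t < 1\<close>, then \<open>zs\<close> would take there the value
  \<open>\<langle>x, zs\<rangle> / t\<close>, above its maximum over \<open>K\<close>. Positivity of the maximum matters: at \<open>0\<close> the gauge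
  is \<open>0\<close>.\<close>

lemma gauge_eq_1_at_support_point:
  assumes x: "x \<in> K" and max: "\<And>k. k \<in> K \<Longrightarrow> \<langle>k, zs\<rangle> \<le> \<langle>x, zs\<rangle>" and pos: "0 < \<langle>x, zs\<rangle>"
  shows "gauge_functional K x = 1"
  unfolding gauge_functional_def
proof (rule antisym)
  show "(INF t\<in>{t. 0 < t \<and> x /\<^sub>R t \<in> K}. ereal t) \<le> 1"
    using x by (intro INF_lower2[of 1]) auto
  show "1 \<le> (INF t\<in>{t. 0 < t \<and> x /\<^sub>R t \<in> K}. ereal t)"
  proof (rule INF_greatest)
    fix t assume "t \<in> {t. 0 < t \<and> x /\<^sub>R t \<in> K}"
    then have "0 < t" "\<langle>x, zs\<rangle> / t \<le> \<langle>x, zs\<rangle>"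
      using max[of "x /\<^sub>R t"] by (auto simp: pairing_simps divide_inverse mult.commute)
    then show "1 \<le> ereal t" using pos by (simp add: field_simps)
  qed
qed

text \<open>For \<open>x\<close> in the predual subdifferential at \<open>xs\<close>, Fenchel-Young equality turns
  \<open>Fs xs + \<langle>x, ys - xs\<rangle>\<close> into \<open>\<langle>x, ys\<rangle> - F x\<close>. When \<open>Fs ys\<close> is finite, minimizing the
  divergence over \<open>xs\<close> therefore means maximizing the dual objective over the points of \<open>K\<close> that
  occur as such subgradients.\<close>

lemma divergence_eq_SUP_dual_objective:
  fixes F :: "'a::locally_convex_space \<Rightarrow> real"
  defines "Fs \<equiv> legendre (ereal \<circ> F)"
  assumes F: "continuous_on UNIV F" "convex_on UNIV F"
    and ne: "predual_subdifferential Fs xs \<inter> K \<noteq> {}"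
  shows "divergence F K ys xs =
    Fs ys - (SUP x\<in>predual_subdifferential Fs xs \<inter> K. ereal (dual_objective F ys x))"
proof -
  let ?A = "predual_subdifferential Fs xs \<inter> K"
  have fy: "Fs xs = ereal (\<langle>x, xs\<rangle> - F x)" if "x \<in> ?A" for x
    using that predual_subdifferential_iff[OF F]
    by (auto simp: Fs_def subdifferential_iff_fenchel_eq)
  obtain c where c: "Fs xs = ereal c" using fy ne by blast
  have "(SUP x\<in>?A. ereal (dual_objective F ys x)) = (SUP x\<in>?A. ereal c + ereal \<langle>x, ys - xs\<rangle>)"
    using fy unfolding c by (intro SUP_cong) (auto simp: dual_objective_def pairing_simps)
  also have "\<dots> = ereal c + (SUP x\<in>?A. ereal \<langle>x, ys - xs\<rangle>)"
    using ne by (intro SUP_ereal_add_right) auto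
  finally show ?thesis
    unfolding divergence_def Fs_def[symmetric] c
    by (cases "Fs ys"; cases "SUP x\<in>?A. ereal \<langle>x, ys - xs\<rangle>") auto
qed

theorem theorem4p5:
  fixes F :: "'a::locally_convex_space \<Rightarrow> real"
    and K :: "'a set"
    and y0s :: "'a topdual"
    and x0 :: 'a
  assumes F_cont: "continuous_on UNIV F"
    and F_convex: "convex_on UNIV F"
    and Fs_strict: "strictly_convex (legendre (ereal \<circ> F))"
    and K_closed: "closed K"
    and K_convex: "convex K"
    and K_nonempty: "K \<noteq> {}"
    and K_sym: "K = uminus ` K"
    and y0s_dom: "y0s \<in> effective_dom (legendre (ereal \<circ> F))"
    and x0_sol: "is_arg_max (dual_objective F y0s) (\<lambda>x. x \<in> K) x0"
  shows "\<exists>x0s.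
    subdifferential F x0 = {x0s} \<and>
    (\<forall>xs. is_arg_min (primal_objective F K y0s) (\<lambda>_. True) xs \<longleftrightarrow> xs = x0s) \<and>
    is_arg_min (divergence F K y0s)
      (\<lambda>xs. predual_subdifferential (legendre (ereal \<circ> F)) xs \<inter> K \<noteq> {}) x0s \<and>
    (INF xs. primal_objective F K y0s xs) = (SUP x\<in>K. ereal (dual_objective F y0s x)) \<and>
    (SUP x\<in>K. ereal (dual_objective F y0s x)) =
      legendre (ereal \<circ> F) y0s - divergence F K y0s x0s \<and>
    (predual_subdifferential (legendre (ereal \<circ> F)) y0s \<inter> K \<noteq> {} \<longrightarrow> x0s = y0s) \<and>
    (predual_subdifferential (legendre (ereal \<circ> F)) y0s \<inter> K = {} \<longrightarrow>
      x0s \<noteq> y0s \<and>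
      (\<forall>x. is_arg_max (dual_objective F y0s) (\<lambda>x. x \<in> K) x \<longrightarrow>
        x \<in> predual_subdifferential (legendre (ereal \<circ> F)) x0s \<and>
        (legendre (convex_indicator K) (x0s - y0s) \<noteq> 0 \<longrightarrow> gauge_functional K x = 1) \<and>
        ereal \<langle>x, y0s - x0s\<rangle> = legendre (convex_indicator K) (x0s - y0s)))"
proof -
  let ?Fs = "legendre (ereal \<circ> F)"
  let ?S = "legendre (convex_indicator K)"
  let ?P = "primal_objective F K y0s"
  let ?d = "dual_objective F y0s"
  let ?D = "divergence F K y0s"
  let ?A = "\<lambda>xs. predual_subdifferential ?Fs xs \<inter> K"
  note predual_iff = predual_subdifferential_iff[OF F_cont F_convex]
  have x0: "x0 \<in> K" and le_d: "\<And>k. k \<in> K \<Longrightarrow> ?d k \<le> ?d x0"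
    using x0_sol by (auto simp: is_arg_max_linorder)
  obtain x0s where x0s: "x0s \<in> subdifferential F x0"
      and normal: "\<And>k. k \<in> K \<Longrightarrow> \<langle>k, y0s - x0s\<rangle> \<le> \<langle>x0, y0s - x0s\<rangle>"
    using optimal_subgradient_exists[OF F_cont F_convex K_convex x0 le_d] by blast
  have sub_x0: "subdifferential F x0 = {x0s}"
    using x0s subdifferential_unique[OF Fs_strict] by blast
  have "?S (x0s - y0s) = ereal \<langle>x0, y0s - x0s\<rangle>"
    using support_le[OF K_sym normal] pairing_le_support[OF K_sym x0] by (rule antisym)
  then have P_x0s: "?P x0s = ereal (?d x0)"
    using x0s by (simp add: duality_gap_zero_iff[OF K_sym x0])
  have P_ge: "ereal (?d x0) \<le> ?P xs" for xs
    using K_sym x0 by (rule weak_duality)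
  have P_eq: "xs = x0s" if "?P xs = ereal (?d x0)" for xs
    using that sub_x0 by (simp add: duality_gap_zero_iff[OF K_sym x0])
  have primal_unique: "is_arg_min ?P (\<lambda>_. True) xs \<longleftrightarrow> xs = x0s" for xs
  proof
    assume "is_arg_min ?P (\<lambda>_. True) xs"
    then have "?P xs \<le> ereal (?d x0)" unfolding P_x0s[symmetric] is_arg_min_linorder by blast
    then show "xs = x0s" using P_ge by (intro P_eq antisym)
  qed (simp add: is_arg_min_linorder P_x0s P_ge)
  have primal_value: "(INF xs. ?P xs) = ereal (?d x0)"
  proof (rule antisym)
    show "(INF xs. ?P xs) \<le> ereal (?d x0)" unfolding P_x0s[symmetric] by (rule INF_lower) simp
  qed (intro INF_greatest P_ge)
  have sup_eq: "(SUP x\<in>B. ereal (?d x)) = ereal (?d x0)" if "x0 \<in> B" "B \<subseteq> K" for B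
    using that le_d by (intro antisym SUP_least SUP_upper) auto
  have x0_A: "x0 \<in> ?A x0s" using x0 x0s by (simp add: predual_iff)
  have Fs_y0s: "\<bar>?Fs y0s\<bar> \<noteq> \<infinity>"
    using y0s_dom legendre_neq_MInf[of F y0s] by (auto simp: effective_dom_def)
  have D_x0s: "?D x0s = ?Fs y0s - ereal (?d x0)"
    using divergence_eq_SUP_dual_objective[OF F_cont F_convex, of x0s K y0s]
      sup_eq[OF x0_A Int_lower2] x0_A by (metis empty_iff)
  have D_ge: "?D x0s \<le> ?D xs" if "?A xs \<noteq> {}" for xs
    unfolding D_x0s divergence_eq_SUP_dual_objective[OF F_cont F_convex that, of y0s]
    using le_d by (intro ereal_minus_mono SUP_least) auto
  have case_meets: "x0s = y0s" if "?A y0s \<noteq> {}"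
  proof -
    obtain x where x: "x \<in> K" "y0s \<in> subdifferential F x"
      using \<open>?A y0s \<noteq> {}\<close> by (auto simp: predual_iff)
    have "?S (y0s - y0s) = 0"
      using K_nonempty by (simp add: legendre_convex_indicator pairing_simps)
    then have "?P y0s = ereal (?d x)"
      using x by (simp add: duality_gap_zero_iff[OF K_sym] pairing_simps)
    then have "?P y0s = ereal (?d x0)" using P_ge[of y0s] le_d[OF x(1)] by simp
    then show ?thesis using P_eq by blast
  qed
  have case_misses: "x \<in> predual_subdifferential ?Fs x0s \<and>
      (?S (x0s - y0s) \<noteq> 0 \<longrightarrow> gauge_functional K x = 1) \<and>
      ereal \<langle>x, y0s - x0s\<rangle> = ?S (x0s - y0s)"
    if "is_arg_max ?d (\<lambda>x. x \<in> K) x" for x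
  proof -
    have x: "x \<in> K" "?d x = ?d x0"
      using that x0 le_d[of x] by (auto simp: is_arg_max_linorder intro!: antisym)
    then have "?P x0s = ereal (?d x)" by (simp add: P_x0s)
    then have sub: "x0s \<in> subdifferential F x" and S: "?S (x0s - y0s) = ereal \<langle>x, y0s - x0s\<rangle>"
      by (simp_all add: duality_gap_zero_iff[OF K_sym x(1)])
    have normal_x: "\<langle>k, y0s - x0s\<rangle> \<le> \<langle>x, y0s - x0s\<rangle>" if "k \<in> K" for k
      using pairing_le_support[OF K_sym that, of y0s x0s] by (simp add: S)
    have "gauge_functional K x = 1" if "?S (x0s - y0s) \<noteq> 0"
    proof (rule gauge_eq_1_at_support_point[OF x(1) normal_x])
      \<comment> \<open>The linear functional is at least as large at \<open>x\<close> as at \<open>- x\<close>, hence nonnegative at \<open>x\<close>.\<close>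
      have "- x \<in> K" using K_sym x(1) by blast
      from normal_x[OF this] show "0 < \<langle>x, y0s - x0s\<rangle>"
        using that by (simp add: S pairing_simps)
    qed
    then show ?thesis using sub S by (simp add: predual_iff)
  qed
  show ?thesis
  proof (intro exI[of _ x0s] conjI impI allI)
    show "is_arg_min ?D (\<lambda>xs. ?A xs \<noteq> {}) x0s"
      using x0_A D_ge by (auto simp: is_arg_min_linorder)
    show "(SUP x\<in>K. ereal (?d x)) = ?Fs y0s - ?D x0s"
      unfolding D_x0s sup_eq[OF x0 order_refl] using Fs_y0s by (cases "?Fs y0s") auto
    show "x0s \<noteq> y0s" if "?A y0s = {}" using that x0_A by auto
    show "(INF xs. ?P xs) = (SUP x\<in>K. ereal (?d x))"
      by (simp only: primal_value sup_eq[OF x0 order_refl])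
    show "x \<in> predual_subdifferential ?Fs x0s"
      and "?S (x0s - y0s) \<noteq> 0 \<Longrightarrow> gauge_functional K x = 1"
      and "ereal \<langle>x, y0s - x0s\<rangle> = ?S (x0s - y0s)"
      if "is_arg_max ?d (\<lambda>x. x \<in> K) x" for x
      using case_misses[OF that] by blast+
  qed (fact sub_x0 primal_unique case_meets)+
qed

end
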